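(* Let $k\ge 2$. If $\tau\in\mathbb M_k$, then $\|\mathrm{nf}_k(\tau)\|\leq\|\tau\|$.
   Context: For $k\ge2$, $\mathbb M_k$ is the set of base $k$ terms of the multiplicative notation system $\mathcal M$: it is the least set containing the constants $0$ and $1$ and closed under $\sigma,\tau\mapsto\sigma+\tau$ and $\tau\mapsto k\cdot\tau$ (multiplication by the base $k$ is a unary operation). Terms are identified modulo associativity of $+$. The value $|\tau|\in\mathbb N$ is the natural number obtained by evaluating the term as an arithmetical expression. The norm is $\|0\|=\|1\|=1$, $\|\sigma+\tau\|=1+\|\sigma\|+\|\tau\|$, $\|k\cdot\tau\|=1+\|\tau\|$. For $q\in\mathbb N$, $\bar 0=0$ and for $q>0$, $\bar q=1+\cdots+1$ ($q$ times). Normal forms: given $m\in\mathbb N$, let $p,q$ be the unique natural numbers with $q<k$ and $m=k\cdot p+q$. If $p=0$, set $\mathrm{nf}_k(m)=\bar q$; if $p>0$ set, inductively, $\mathrm{nf}_k(m)=k\cdot\mathrm{nf}_k(p)+\bar q$, where the summand $\bar q$ (and the addition) is omitted if $q=0$. For a term $\tau\in\mathbb M_k$, $\mathrm{nf}_k(\tau)=\mathrm{nf}_k(|\tau|)$. *)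

theory Defs
  imports Main
begin

text \<open>Raw terms over all bases: in \<open>PTimes k t\<close> the base \<open>k\<close> is part of the unary operation symbol,
  as in $k \cdot \tau$. The set \<open>M k\<close> below admits only the one base \<open>k\<close>.\<close>

datatype pterm = PZero | POne | PPlus pterm pterm | PTimes nat pterm

inductive assoc_eq :: "pterm \<Rightarrow> pterm \<Rightarrow> bool" where
  refl: "assoc_eq s s"
| sym: "assoc_eq s t \<Longrightarrow> assoc_eq t s"
| trans: "assoc_eq s t \<Longrightarrow> assoc_eq t u \<Longrightarrow> assoc_eq s u"
| assoc: "assoc_eq (PPlus (PPlus s t) u) (PPlus s (PPlus t u))"
| plus: "assoc_eq s s' \<Longrightarrow> assoc_eq t t' \<Longrightarrow> assoc_eq (PPlus s t) (PPlus s' t')"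
| times: "assoc_eq s s' \<Longrightarrow> assoc_eq (PTimes k s) (PTimes k s')"

quotient_type mterm = pterm / assoc_eq
  by (intro equivpI reflpI sympI transpI)
    (auto intro: assoc_eq.refl assoc_eq.sym assoc_eq.trans)

text \<open>The classes supply only the notation and associativity: \<^term>\<open>0\<close> is not neutral for
  addition of terms, and addition is not commutative.\<close>

instantiation mterm :: "{zero, one, semigroup_add}"
begin

lift_definition zero_mterm :: mterm is PZero .

lift_definition one_mterm :: mterm is POne .

lift_definition plus_mterm :: "mterm \<Rightarrow> mterm \<Rightarrow> mterm" is PPlus
  by (rule assoc_eq.plus)

instance
  by standard (transfer, rule assoc_eq.assoc)

end

lift_definition times_base :: "nat \<Rightarrow> mterm \<Rightarrow> mterm"  (infixr \<open>\<cdot>\<close> 70) is PTimes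
  by (rule assoc_eq.times)

inductive_set M :: "nat \<Rightarrow> mterm set" for k :: nat where
  zero: "0 \<in> M k"
| one: "1 \<in> M k"
| plus: "\<sigma> \<in> M k \<Longrightarrow> \<tau> \<in> M k \<Longrightarrow> \<sigma> + \<tau> \<in> M k"
| times: "\<tau> \<in> M k \<Longrightarrow> k \<cdot> \<tau> \<in> M k"

primrec pvalue :: "pterm \<Rightarrow> nat" where
  "pvalue PZero = 0"
| "pvalue POne = 1"
| "pvalue (PPlus s t) = pvalue s + pvalue t"
| "pvalue (PTimes k t) = k * pvalue t"

primrec pnorm :: "pterm \<Rightarrow> nat" where
  "pnorm PZero = 1"
| "pnorm POne = 1"
| "pnorm (PPlus s t) = 1 + pnorm s + pnorm t"
| "pnorm (PTimes k t) = 1 + pnorm t"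

lift_definition mvalue :: "mterm \<Rightarrow> nat" is pvalue
proof -
  fix s t show "assoc_eq s t \<Longrightarrow> pvalue s = pvalue t"
    by (induction rule: assoc_eq.induct) auto
qed

lift_definition mnorm :: "mterm \<Rightarrow> nat" is pnorm
proof -
  fix s t show "assoc_eq s t \<Longrightarrow> pnorm s = pnorm t"
    by (induction rule: assoc_eq.induct) auto
qed

fun bar :: "nat \<Rightarrow> mterm" where
  "bar 0 = 0"
| "bar (Suc 0) = 1"
| "bar (Suc (Suc n)) = bar (Suc n) + 1"

text \<open>\<open>nf_nat k m\<close> is the normal form of a number, \<open>nf k \<tau>\<close> that of a term. The guard \<open>k < 2\<close> only serves termination; normal forms are meant for \<open>k \<ge> 2\<close>.\<close>

function nf_nat :: "nat \<Rightarrow> nat \<Rightarrow> mterm" where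
  "nf_nat k m =
    (let p = m div k; q = m mod k in
     if k < 2 \<or> p = 0 then bar q
     else if q = 0 then k \<cdot> nf_nat k p
     else k \<cdot> nf_nat k p + bar q)"
  by pat_completeness auto
termination
proof (relation "measure snd")
  fix k m p q :: nat
  assume "p = m div k" and "\<not> (k < 2 \<or> p = 0)"
  then show "((k, p), (k, m)) \<in> measure snd"
    by (cases "m = 0") auto
next
  fix k m p q :: nat
  assume "p = m div k" and "\<not> (k < 2 \<or> p = 0)"
  then show "((k, p), (k, m)) \<in> measure snd"
    by (cases "m = 0") auto
qed simp

declare nf_nat.simps [simp del]

definition nf :: "nat \<Rightarrow> mterm \<Rightarrow> mterm" where
  "nf k \<tau> = nf_nat k (mvalue \<tau>)"

end

theory Submission
  imports Defs
begin

text \<open>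
  The theorem follows by induction on \<open>\<tau>\<close> once the norm of normal forms, as a function of the
  value, is known to grow no faster than the norm of terms: passing from \<open>m\<close> and \<open>n\<close> to \<open>m + n\<close>,
  or from \<open>m\<close> to \<open>k * m\<close>, must not cost more than one additional operation symbol.

  For \<open>m > 0\<close> with base \<open>k\<close> digits \<open>d\<^sub>l \<dots> d\<^sub>0\<close>, the normal form has one occurrence of \<open>k \<cdot>\<close> for every
  digit except the leading one, \<open>d\<^sub>l + \<dots> + d\<^sub>0\<close> ones, and plus signs joining these ones, one fewer
  than their number.
  One plus its norm is therefore \<open>2 * (d\<^sub>l + \<dots> + d\<^sub>0) + l\<close>. This quantity is called the weight
  of \<open>m\<close> below; with the value \<open>0\<close> at \<open>0\<close>, the bound for sums becomes plain subadditivity of the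
  weight. Subadditivity (\<open>weight_add_le\<close>) rests on the fact that adding \<open>1\<close> increases the weight
  by at most \<open>2\<close> (\<open>weight_Suc_le\<close>): a carry may create a new digit, but it also
  replaces a digit \<open>k - 1\<close>, which weighs at least \<open>2\<close>, by \<open>0\<close>.
\<close>

lemma mnorm_simps:
  "mnorm 0 = 1" "mnorm 1 = 1"
  "mnorm (\<sigma> + \<tau>) = 1 + mnorm \<sigma> + mnorm \<tau>"
  "mnorm (k \<cdot> \<tau>) = 1 + mnorm \<tau>"
  by (transfer, simp)+

lemma mvalue_simps:
  "mvalue 0 = 0" "mvalue 1 = 1"
  "mvalue (\<sigma> + \<tau>) = mvalue \<sigma> + mvalue \<tau>"
  "mvalue (k \<cdot> \<tau>) = k * mvalue \<tau>"
  by (transfer, simp)+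

lemma mnorm_bar_Suc: "mnorm (bar (Suc n)) = Suc (2 * n)"
  by (induction n) (auto simp: mnorm_simps)

text \<open>
  Among positive numbers, one more than the norm of the normal form is the subadditive quantity,
  since the increment accounts for the plus sign that joins two summands. The term \<open>0\<close> has norm \<open>1\<close>, but
  it does not occur in the normal form of a positive number; the value \<open>0\<close> at \<open>0\<close> reflects this.
\<close>

definition weight :: "nat \<Rightarrow> nat \<Rightarrow> nat" where
  "weight k m = (if m = 0 then 0 else Suc (mnorm (nf_nat k m)))"

lemma weight_0 [simp]: "weight k 0 = 0"
  by (simp add: weight_def)

lemma mnorm_nf_nat_0: "mnorm (nf_nat k 0) = 1"
  by (simp add: nf_nat.simps[of k 0] mnorm_simps)

lemma weight_digit:
  assumes "q < k"
  shows "weight k q = 2 * q"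
proof -
  have "nf_nat k q = bar q"
    using assms by (subst nf_nat.simps) simp
  then show ?thesis
    by (cases q) (simp_all add: weight_def mnorm_bar_Suc)
qed

lemma weight_append_digit:
  assumes "k \<ge> 2" "p > 0" "q < k"
  shows "weight k (k * p + q) = weight k p + 1 + 2 * q"
proof -
  have "nf_nat k (k * p + q) = (if q = 0 then k \<cdot> nf_nat k p else k \<cdot> nf_nat k p + bar q)"
    using assms by (subst nf_nat.simps) simp
  then show ?thesis
    using assms by (cases q) (simp_all add: weight_def mnorm_simps mnorm_bar_Suc)
qed

text \<open>
  The only case in which the last digit does not simply grow by \<open>1\<close> is the carry. It removes a
  digit \<open>k - 1\<close> of weight \<open>2 * (k - 1)\<close>, which is at least \<open>2\<close>. The higher digits gain at most \<open>2\<close>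
  by induction, or else a new leading digit \<open>1\<close> appears, which together with its shift weighs \<open>3\<close>.
\<close>

lemma weight_Suc_le:
  assumes k: "k \<ge> 2"
  shows "weight k (Suc m) \<le> weight k m + 2"
proof (induction m rule: less_induct)
  case (less m)
  define p q where "p = m div k" and "q = m mod k"
  have m: "m = k * p + q" and q: "q < k"
    using k by (simp_all add: p_def q_def)
  show ?case
  proof (cases "Suc q < k")
    case True
    with k show ?thesis
      using weight_append_digit[of k p "Suc q"] weight_append_digit[of k p q]
        weight_digit[of "Suc q" k] weight_digit[of q k]
      by (cases "p = 0") (simp_all add: m)
  next
    case False
    with q have carry: "k = Suc q" by simp
    have Suc_m: "Suc m = k * Suc p"
      by (simp add: m carry)
    have w_Suc_m: "weight k (Suc m) = weight k (Suc p) + 1"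
      using weight_append_digit[of k "Suc p" 0] k unfolding Suc_m by simp
    show ?thesis
    proof (cases "p = 0")
      case True
      then show ?thesis
        using w_Suc_m weight_digit[of 1 k] weight_digit[of q k] k carry m by simp
    next
      case False
      then have "p < m"
        using k m by (cases k) (auto simp: carry)
      then have "weight k (Suc p) \<le> weight k p + 2"
        by (rule less.IH)
      then show ?thesis
        using w_Suc_m weight_append_digit[of k p q] False k carry by (simp add: m)
    qed
  qed
qed

lemma weight_add_le_double:
  assumes "k \<ge> 2"
  shows "weight k (m + n) \<le> weight k m + 2 * n"
proof (induction n)
  case (Suc n)
  then show ?case
    using weight_Suc_le[OF assms, of "m + n"] by simp
qed simp

text \<open>
  Adding a single digit is covered by repeated increments, because a digit \<open>q\<close> weighs exactly
  \<open>2 * q\<close>. Otherwise both last digits are split off, the higher parts are added first, and the sum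
  of the two last digits is again added by increments. The two shifts by the base merge into one,
  so a weight of \<open>1\<close> is even saved.
\<close>

lemma weight_add_le:
  assumes k: "k \<ge> 2"
  shows "weight k (m + n) \<le> weight k m + weight k n"
proof (induction m arbitrary: n rule: less_induct)
  case (less m)
  define p q where "p = m div k" and "q = m mod k"
  define p' q' where "p' = n div k" and "q' = n mod k"
  have m: "m = k * p + q" and q: "q < k" and n: "n = k * p' + q'" and q': "q' < k"
    using k by (simp_all add: p_def q_def p'_def q'_def)
  consider "p = 0" | "p' = 0" | "p > 0" "p' > 0" by auto
  then show ?case
  proof cases
    case 1
    then show ?thesis
      using weight_add_le_double[OF k, of n q] weight_digit[OF q] by (simp add: m add.commute)
  next
    case 2
    then show ?thesis
      using weight_add_le_double[OF k, of m q'] weight_digit[OF q'] by (simp add: n)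
  next
    case 3
    then have "p < m"
      using k by (cases "m = 0") (simp_all add: p_def)
    have "weight k (m + n) \<le> weight k (k * (p + p')) + 2 * (q + q')"
      using weight_add_le_double[OF k, of "k * (p + p')" "q + q'"]
      by (simp add: m n algebra_simps)
    also have "weight k (k * (p + p')) = weight k (p + p') + 1"
      using weight_append_digit[of k "p + p'" 0] k 3 by simp
    also have "weight k (p + p') \<le> weight k p + weight k p'"
      using \<open>p < m\<close> by (rule less.IH)
    finally show ?thesis
      using weight_append_digit[OF k 3(1) q] weight_append_digit[OF k 3(2) q']
      by (simp add: m n)
  qed
qed

lemma mnorm_nf_nat_add_le:
  assumes "k \<ge> 2"
  shows "mnorm (nf_nat k (m + n)) \<le> 1 + mnorm (nf_nat k m) + mnorm (nf_nat k n)"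
  using weight_add_le[OF assms, of m n]
  by (cases "m = 0"; cases "n = 0") (simp_all add: weight_def)

lemma mnorm_nf_nat_times_le:
  assumes "k \<ge> 2"
  shows "mnorm (nf_nat k (k * m)) \<le> 1 + mnorm (nf_nat k m)"
  using assms weight_append_digit[of k m 0]
  by (cases "m = 0") (simp_all add: weight_def)

theorem theorem4p2:
  fixes k :: nat and \<tau> :: mterm
  assumes "k \<ge> 2" and "\<tau> \<in> M k"
  shows "mnorm (nf k \<tau>) \<le> mnorm \<tau>"
  using assms(2)
proof (induction rule: M.induct)
  case zero
  show ?case
    by (simp add: nf_def mvalue_simps mnorm_simps mnorm_nf_nat_0)
next
  case one
  show ?case
    using weight_digit[of 1 k] assms(1) by (simp add: nf_def mvalue_simps mnorm_simps weight_def)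
next
  case (plus \<sigma> \<tau>)
  then show ?case
    using mnorm_nf_nat_add_le[OF assms(1), of "mvalue \<sigma>" "mvalue \<tau>"]
    by (simp add: nf_def mvalue_simps mnorm_simps)
next
  case (times \<tau>)
  then show ?case
    using mnorm_nf_nat_times_le[OF assms(1), of "mvalue \<tau>"]
    by (simp add: nf_def mvalue_simps mnorm_simps)
qed

end
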